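(* Let $p$ be an odd prime. If $H$ is a finite $p$-group of nilpotence class $2$ and exponent $p$, then there is an ultraspecial group $G$ that has a subgroup isomorphic to $H$.
   Context: A finite $p$-group $G$ is semi-extraspecial if for every subgroup $N$ of index $p$ in $Z(G)$ the quotient $G/N$ is an extraspecial group. A semi-extraspecial group $G$ is ultraspecial if $|G'| = |G:G'|^{1/2}$. *)

theory Defs
  imports Complex_Main "HOL-Algebra.Algebra"
begin

(* Divisibility also defines a constant named prime, hence the qualified Factorial_Ring.prime. *)

definition finite_p_group :: "nat \<Rightarrow> ('a, 'b) monoid_scheme \<Rightarrow> bool" where
  "finite_p_group p G \<longleftrightarrow>
     Factorial_Ring.prime p \<and> group G \<and> finite (carrier G) \<and> (\<exists>n. order G = p ^ n)"

(* This is 0 if there is no common bound on the orders (group.ord is 0 for infinite order). *)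
definition group_exponent :: "('a, 'b) monoid_scheme \<Rightarrow> nat" where
  "group_exponent G = Lcm (group.ord G ` carrier G)"

(* Indexing starts at 0: lower_central_series G n is the term usually written gamma_(n+1)(G). *)
primrec lower_central_series :: "('a, 'b) monoid_scheme \<Rightarrow> nat \<Rightarrow> 'a set" where
  "lower_central_series G 0 = carrier G"
| "lower_central_series G (Suc n) =
     generate G (\<Union>x \<in> lower_central_series G n. \<Union>y \<in> carrier G.
       {x \<otimes>\<^bsub>G\<^esub> y \<otimes>\<^bsub>G\<^esub> inv\<^bsub>G\<^esub> x \<otimes>\<^bsub>G\<^esub> inv\<^bsub>G\<^esub> y})"

definition nilpotent_group :: "('a, 'b) monoid_scheme \<Rightarrow> bool" where
  "nilpotent_group G \<longleftrightarrow> group G \<and> (\<exists>n. lower_central_series G n = {\<one>\<^bsub>G\<^esub>})"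

(* The exact class, meaningful only for nilpotent groups: abelian groups have class at most 1. *)
definition nilpotence_class :: "('a, 'b) monoid_scheme \<Rightarrow> nat" where
  "nilpotence_class G = (LEAST n. lower_central_series G n = {\<one>\<^bsub>G\<^esub>})"

definition group_center :: "('a, 'b) monoid_scheme \<Rightarrow> 'a set" where
  "group_center G = {z \<in> carrier G. \<forall>g \<in> carrier G. g \<otimes>\<^bsub>G\<^esub> z = z \<otimes>\<^bsub>G\<^esub> g}"

definition elementary_abelian :: "nat \<Rightarrow> ('a, 'b) monoid_scheme \<Rightarrow> bool" where
  "elementary_abelian p G \<longleftrightarrow>
     finite_p_group p G \<and> comm_group G \<and> (\<forall>x \<in> carrier G. x [^]\<^bsub>G\<^esub> p = \<one>\<^bsub>G\<^esub>)"

definition extraspecial :: "nat \<Rightarrow> ('a, 'b) monoid_scheme \<Rightarrow> bool" where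
  "extraspecial p G \<longleftrightarrow>
     finite_p_group p G \<and> card (group_center G) = p \<and>
     elementary_abelian p (G Mod group_center G) \<and> order (G Mod group_center G) \<noteq> 1"

(* Every subgroup N of the center is normal in G, so G Mod N is the quotient group. *)
definition semi_extraspecial :: "nat \<Rightarrow> ('a, 'b) monoid_scheme \<Rightarrow> bool" where
  "semi_extraspecial p G \<longleftrightarrow>
     finite_p_group p G \<and>
     (\<forall>N. subgroup N (G\<lparr>carrier := group_center G\<rparr>) \<and>
          card (rcosets\<^bsub>G\<lparr>carrier := group_center G\<rparr>\<^esub> N) = p \<longrightarrow>
          extraspecial p (G Mod N))"

definition ultraspecial :: "nat \<Rightarrow> ('a, 'b) monoid_scheme \<Rightarrow> bool" where
  "ultraspecial p G \<longleftrightarrow>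
     semi_extraspecial p G \<and>
     real (card (derived G (carrier G))) =
       sqrt (real (card (rcosets\<^bsub>G\<^esub> (derived G (carrier G)))))"

end

(*
  A central extension H of V = H/Z(H) by Z(H) is given by a cocycle V x V -> Z(H). As H has
  exponent p and class 2, both V and Z(H) are elementary abelian. Choose a finite field F of
  characteristic p with |F| >= |H|, an embedding of V as a direct factor of (F,+), and an embedding
  of Z(H) into (F,+). Pulling the cocycle back along the projection F -> V and pushing it forward
  along Z(H) -> F gives a cocycle t : F x F -> F. The triples (a, b, c) in F^3 with product
  (a + a', b + b', c + c' + a b' + t(b, b')) form a group containing H inside {a = 0}. For
  (a, b) <> (0, 0) every (0, 0, z) is a commutator with (a, b, c), whatever t is: take the other
  factor with b' = 0 if b <> 0, and with a' = 0 if b = 0. This makes the group ultraspecial.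
*)
theory Submission
  imports Defs "HOL-Number_Theory.Residues"
begin

section \<open>Finite fields of large order\<close>

text \<open>In \<open>H\<close> the commutators of a noncentral element may fill only a proper
  subgroup of Z(H), so \<open>H\<close> itself can fail the condition on quotients. The coordinate a
  repairs this: it is paired with b by the multiplication of F, and division in F solves for a
  partner with any prescribed commutator. The commutator of (a, b, c) and (a', b', c') has third
  coordinate a b' - a' b + t(b, b') - t(b', b). As t is normalised (zero when one argument is zero),
  the chosen partners never see it, so the raw cocycle of a set-theoretic section can be used as it
  is. Three coordinates of equal size give |G'| = |F| and |G : G'| = |F|^2, the proportion that
  ultraspecial demands. For V an embedding alone would not do: t has to be defined on all of F,
  hence the direct factor, which takes the form of a retraction. Linear algebra over the prime field
  is replaced by maximal subgroups of direct products.\<close>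

lemma (in algebraically_closed) infinite_carrier:
  assumes "\<one> \<noteq> \<ominus> \<one>"
  shows "infinite (carrier L)"
proof
  assume fin: "finite (carrier L)"
  \<comment> \<open>Every element of an algebraically closed field is a square, so squaring is onto;
    on a finite carrier it would be injective too, yet it identifies 1 and -1.\<close>
  have "carrier L \<subseteq> (\<lambda>x. x \<otimes> x) ` carrier L"
  proof
    fix d assume d: "d \<in> carrier L"
    have P: "[\<one>, \<zero>, \<ominus> d] \<in> carrier (poly_ring L)"
      using d by (simp add: univ_poly_def polynomial_def)
    have "size (roots [\<one>, \<zero>, \<ominus> d]) = 2"
      using roots_over_carrier[OF P] by (simp add: splitted_def)
    then have "roots [\<one>, \<zero>, \<ominus> d] \<noteq> {#}"
      by auto
    then obtain x where "x \<in># roots [\<one>, \<zero>, \<ominus> d]"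
      by blast
    then have x: "x \<in> carrier L" "eval [\<one>, \<zero>, \<ominus> d] x = \<zero>"
      using roots_mem_iff_is_root[OF P] by (auto simp: is_root_def)
    then have "x \<otimes> x \<ominus> d = \<zero>"
      using d by (simp add: minus_eq numeral_2_eq_2)
    then have "d = x \<otimes> x"
      using d x(1) by simp
    then show "d \<in> (\<lambda>x. x \<otimes> x) ` carrier L"
      using x(1) by blast
  qed
  then have "inj_on (\<lambda>x. x \<otimes> x) (carrier L)"
    using fin by (intro finite_surj_inj) auto
  moreover have "\<one> \<otimes> \<one> = \<ominus> \<one> \<otimes> \<ominus> \<one>"
    by algebra
  ultimately show False
    using assms inj_onD[of "\<lambda>x. x \<otimes> x" "carrier L" "\<one>" "\<ominus> \<one>"] by simp
qed

text \<open>Transport of structure: it moves the finite field from the large type of the algebraic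
  closure to the natural numbers.\<close>

lemma (in field) inj_imp_image_ring_field:
  assumes "inj_on f (carrier R)"
  shows "f \<in> ring_iso R (image_ring f R)" and "field (image_ring f R)"
proof -
  show iso: "f \<in> ring_iso R (image_ring f R)"
    using assms by (intro ring_iso_memI)
      (auto simp: image_ring_def image_group_def monoid.defs bij_betw_def)
  show "field (image_ring f R)"
    using ring_iso_imp_img_field[OF iso] by (simp add: image_ring_def image_group_def monoid.defs)
qed

lemma (in ring) finite_dimension_imp_finite:
  assumes "subfield K R" and "finite K" and "finite_dimension K E"
  shows "finite E"
proof -
  obtain n where "dimension n K E"
    using assms(3) by auto
  then obtain Us where Us: "set Us \<subseteq> carrier R" "Span K Us = E"
    using exists_base[OF assms(1)] by blast
  have "E = (\<lambda>Ks. combine Ks Us) ` {Ks. set Ks \<subseteq> K \<and> length Ks = length Us}"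
    using Span_eq_combine_set_length_version[OF assms(1) Us(1)] Us(2) by auto
  then show ?thesis
    using finite_lists_length_eq[OF assms(2)] by simp
qed

lemma (in ring_hom_ring) hom_add_pow:
  fixes n :: nat
  assumes "x \<in> carrier R"
  shows "h ([n] \<cdot> x) = [n] \<cdot>\<^bsub>S\<^esub> h x"
proof -
  interpret add: group_hom "add_monoid R" "add_monoid S" h
    using R.add.is_group S.add.is_group
    by (auto simp: group_hom_def group_hom_axioms_def hom_def)
  show ?thesis
    using add.hom_nat_pow[of x n] assms by (simp add: add_pow_def)
qed

text \<open>A subfield of the algebraic closure of the prime field: adjoin \<open>n\<close> elements of the infinite
  closure to the prime field, which gives an extension of finite degree.\<close>
lemma exists_finite_field:
  fixes p n :: nat
  assumes "Factorial_Ring.prime p" and "odd p"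
  obtains F :: "nat ring"
  where "field F" and "finite (carrier F)" and "n \<le> card (carrier F)"
    and "\<And>x. x \<in> carrier F \<Longrightarrow> [p] \<cdot>\<^bsub>F\<^esub> x = \<zero>\<^bsub>F\<^esub>"
proof -
  define R where "R = residue_ring (int p)"
  interpret R: residues_prime p R
    by unfold_locales (simp_all add: assms R_def)
  define L where "L = R.alg_closure"
  define h where "h = (R.indexed_const :: int \<Rightarrow> (int list \<times> nat) multiset \<Rightarrow> int)"
  define K where "K = h ` carrier R"
  interpret L: algebraic_closure L K
    unfolding L_def K_def h_def by (rule R.alg_closureE)
  interpret hom: ring_hom_ring R L h
    using R.alg_closureE(2) R.is_ring L.is_ring
    by (simp add: L_def h_def ring_hom_ring_def ring_hom_ring_axioms_def)
  have K: "subfield K L" "finite K"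
    using L.subfield_axioms by (simp_all add: K_def)
  have p_one: "[p] \<cdot>\<^bsub>L\<^esub> \<one>\<^bsub>L\<^esub> = \<zero>\<^bsub>L\<^esub>"
  proof -
    have "[p] \<cdot>\<^bsub>R\<^esub> \<one>\<^bsub>R\<^esub> = \<zero>\<^bsub>R\<^esub>"
      using R.add.pow_order_eq_1[OF R.one_closed]
      by (simp add: order_def R.res_carrier_eq)
    then show ?thesis
      by (metis hom.hom_add_pow hom.hom_one hom.hom_zero R.one_closed)
  qed
  have p_mult: "[p] \<cdot>\<^bsub>L\<^esub> x = \<zero>\<^bsub>L\<^esub>" if "x \<in> carrier L" for x
    using L.add_pow_ldistr[of "\<one>\<^bsub>L\<^esub>" x p] that p_one by simp
  \<comment> \<open>Oddness of \<open>p\<close> enters here: with \<open>p = 2 * k + 1\<close>, a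
    vanishing 1 + 1 would make the sum of \<open>p\<close> ones equal to one, but it is
    zero.\<close>
  have "\<one>\<^bsub>L\<^esub> \<noteq> \<ominus>\<^bsub>L\<^esub> \<one>\<^bsub>L\<^esub>"
  proof
    assume "\<one>\<^bsub>L\<^esub> = \<ominus>\<^bsub>L\<^esub> \<one>\<^bsub>L\<^esub>"
    then have "\<one>\<^bsub>L\<^esub> \<oplus>\<^bsub>L\<^esub> \<one>\<^bsub>L\<^esub> = \<one>\<^bsub>L\<^esub> \<oplus>\<^bsub>L\<^esub> \<ominus>\<^bsub>L\<^esub> \<one>\<^bsub>L\<^esub>"
      by (rule arg_cong)
    also have "\<dots> = \<zero>\<^bsub>L\<^esub>"
      by (simp add: L.r_neg)
    finally have "\<one>\<^bsub>L\<^esub> \<oplus>\<^bsub>L\<^esub> \<one>\<^bsub>L\<^esub> = \<zero>\<^bsub>L\<^esub>" .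
    then have two: "add_pow L (2::nat) \<one>\<^bsub>L\<^esub> = \<zero>\<^bsub>L\<^esub>"
      by (simp add: numeral_2_eq_2)
    obtain k where k: "p = 2 * k + (1::nat)"
      using \<open>odd p\<close> by (rule oddE)
    have "[p] \<cdot>\<^bsub>L\<^esub> \<one>\<^bsub>L\<^esub> = [k] \<cdot>\<^bsub>L\<^esub> (add_pow L (2::nat) \<one>\<^bsub>L\<^esub>) \<oplus>\<^bsub>L\<^esub> \<one>\<^bsub>L\<^esub>"
      by (simp add: k L.add.nat_pow_pow)
    with p_one two show False
      by simp
  qed
  then have "infinite (carrier L)"
    by (rule L.infinite_carrier)
  then obtain A where A: "finite A" "card A = n" "A \<subseteq> carrier L"
    using infinite_arbitrarily_large by metis
  then obtain xs where xs: "set xs = A"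
    using finite_list by metis
  define E where "E = L.finite_extension K xs"
  have alg: "(L.algebraic over K) x" if "x \<in> set xs" for x
    using that A(3) xs L.algebraic_extension by blast
  have subE: "subfield E L"
    unfolding E_def using A xs alg K by (intro L.finite_extension_is_subfield) auto
  have "L.finite_dimension K E"
    unfolding E_def using A xs alg K by (intro L.finite_extension_finite_dimension(1)) auto
  then have finE: "finite E"
    using L.finite_dimension_imp_finite K by blast
  have "A \<subseteq> E"
    unfolding E_def using L.finite_extension_mem[OF subfieldE(1)[OF K(1)], of xs] A(3) xs by simp
  then have cardE: "n \<le> card E"
    using card_mono finE A(2) by metis
  obtain f :: "_ \<Rightarrow> nat" where f: "inj_on f E"
    using finite_imp_inj_to_nat_seg[OF finE] by blast
  interpret E: field "L\<lparr>carrier := E\<rparr>"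
    using L.subfield_iff(2)[OF subE] .
  define F where "F = image_ring f (L\<lparr>carrier := E\<rparr>)"
  have iso: "f \<in> ring_iso (L\<lparr>carrier := E\<rparr>) F" and F: "field F"
    unfolding F_def by (simp_all add: E.inj_imp_image_ring_field f)
  have carrier_F: "carrier F = f ` E"
    by (simp add: F_def image_ring_carrier)
  interpret F: field F by (rule F)
  interpret f: ring_hom_ring "L\<lparr>carrier := E\<rparr>" F f
    using iso E.is_ring F.is_ring
    by (simp add: ring_iso_def ring_hom_ring_def ring_hom_ring_axioms_def)
  show thesis
  proof
    show "field F" "finite (carrier F)" "n \<le> card (carrier F)"
      using F cardE finE f by (simp_all add: carrier_F card_image)
    fix y assume "y \<in> carrier F"
    then obtain x where x: "x \<in> E" "y = f x"
      by (auto simp: carrier_F)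
    then have "[p] \<cdot>\<^bsub>F\<^esub> y = f ([p] \<cdot>\<^bsub>L\<lparr>carrier := E\<rparr>\<^esub> x)"
      using f.hom_add_pow[of x p] by simp
    also have "[p] \<cdot>\<^bsub>L\<lparr>carrier := E\<rparr>\<^esub> x = [p] \<cdot>\<^bsub>L\<^esub> x"
      by (simp add: add_pow_def nat_pow_def)
    also have "\<dots> = \<zero>\<^bsub>L\<^esub>"
      using x(1) subfieldE(3)[OF subE] p_mult by blast
    finally show "[p] \<cdot>\<^bsub>F\<^esub> y = \<zero>\<^bsub>F\<^esub>"
      using f.hom_zero by simp
  qed
qed

section \<open>Semi-extraspecial groups and commutators\<close>

lemma (in group) subgroup_group_center: "subgroup (group_center G) G"
proof (rule subgroupI)
  show "group_center G \<noteq> {}"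
    by (auto simp: group_center_def)
  fix z assume z: "z \<in> group_center G"
  then have zG: "z \<in> carrier G"
    by (simp add: group_center_def)
  have "g \<otimes> inv z = inv z \<otimes> g" if g: "g \<in> carrier G" for g
  proof -
    have "g \<otimes> inv z = inv z \<otimes> (z \<otimes> g) \<otimes> inv z"
      using zG g by (simp add: m_assoc[symmetric])
    also have "z \<otimes> g = g \<otimes> z"
      using z g by (simp add: group_center_def)
    finally show ?thesis
      using zG g by (simp add: m_assoc)
  qed
  then show "inv z \<in> group_center G"
    using zG by (simp add: group_center_def)
  fix w assume w: "w \<in> group_center G"
  then have wG: "w \<in> carrier G"
    by (simp add: group_center_def)
  have "g \<otimes> (z \<otimes> w) = z \<otimes> w \<otimes> g" if g: "g \<in> carrier G" for g
  proof -
    have gz: "g \<otimes> z = z \<otimes> g" and gw: "g \<otimes> w = w \<otimes> g"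
      using z w g by (simp_all add: group_center_def)
    have "g \<otimes> (z \<otimes> w) = z \<otimes> g \<otimes> w"
      using zG wG g by (simp add: m_assoc flip: gz)
    also have "\<dots> = z \<otimes> w \<otimes> g"
      using zG wG g by (simp add: m_assoc gw)
    finally show ?thesis .
  qed
  then show "z \<otimes> w \<in> group_center G"
    using zG wG by (simp add: group_center_def)
qed (auto simp: group_center_def)

lemma (in group) subgroup_center_normal:
  assumes "subgroup N G" and "N \<subseteq> group_center G"
  shows "N \<lhd> G"
  unfolding normal_inv_iff
proof (intro conjI ballI assms(1))
  fix x h assume x: "x \<in> carrier G" and h: "h \<in> N"
  then have "x \<otimes> h = h \<otimes> x" "h \<in> carrier G"
    using assms(2) by (auto simp: group_center_def)
  then show "x \<otimes> h \<otimes> inv x \<in> N"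
    using x h by (simp add: m_assoc)
qed

lemma (in normal) FactGroup_finite_p_group:
  assumes "finite_p_group p G"
  shows "finite_p_group p (G Mod H)"
proof -
  obtain n where p: "Factorial_Ring.prime p" and fin: "finite (carrier G)" and "order G = p ^ n"
    using assms by (auto simp: finite_p_group_def)
  moreover have "order (G Mod H) dvd order G"
    using lagrange[OF subgroup_axioms, symmetric] by (simp add: FactGroup_def order_def)
  ultimately have "\<exists>m. order (G Mod H) = p ^ m"
    by (auto simp: divides_primepow_nat)
  then show ?thesis
    using p fin factorgroup_is_group by (simp add: finite_p_group_def carrier_FactGroup)
qed

lemma (in normal) rcos_eq_iff:
  assumes "x \<in> carrier G" "y \<in> carrier G"
  shows "H #> x = H #> y \<longleftrightarrow> x \<in> H #> y"
  using assms repr_independence repr_independenceD subgroup_axioms by metis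

lemma (in normal) FactGroup_elementary_abelian:
  assumes "finite_p_group p G"
    and "\<And>x y. x \<in> carrier G \<Longrightarrow> y \<in> carrier G \<Longrightarrow> x \<otimes> y \<in> H #> (y \<otimes> x)"
    and "\<And>x. x \<in> carrier G \<Longrightarrow> x [^] p \<in> H"
  shows "elementary_abelian p (G Mod H)"
  unfolding elementary_abelian_def
proof (intro conjI ballI)
  interpret Q: group "G Mod H"
    by (rule factorgroup_is_group)
  show "finite_p_group p (G Mod H)"
    using assms(1) by (rule FactGroup_finite_p_group)
  have "H #> (x \<otimes> y) = H #> (y \<otimes> x)" if "x \<in> carrier G" "y \<in> carrier G" for x y
    using that assms(2) rcos_eq_iff by simp
  then show "comm_group (G Mod H)"
    by (intro Q.group_comm_groupI) (auto simp: carrier_FactGroup rcos_sum)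
  fix K assume "K \<in> carrier (G Mod H)"
  then obtain x where x: "x \<in> carrier G" "K = H #> x"
    by (auto simp: carrier_FactGroup)
  then have "K [^]\<^bsub>G Mod H\<^esub> p = H #> (x [^] p)"
    by (simp add: FactGroup_pow)
  also have "\<dots> = H"
    using assms(3)[OF x(1)] x(1) coset_join2 subgroup_axioms by simp
  finally show "K [^]\<^bsub>G Mod H\<^esub> p = \<one>\<^bsub>G Mod H\<^esub>"
    by simp
qed

text \<open>The assumption \<open>camina\<close> says that the commutators of a noncentral element
  fill the centre; the equation \<open>x \<otimes> y = z \<otimes> (y \<otimes> x)\<close> expresses
  [x, y] = z without inverses, which suits computation in coordinates. If a noncentral
  \<open>x\<close> became central modulo \<open>N\<close>, all its commutators would lie in
  \<open>N\<close>, but a central \<open>z\<close> outside \<open>N\<close> is among them.\<close>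

lemma (in group) group_center_FactGroup:
  assumes N: "subgroup N G" "N \<subset> group_center G"
    and camina: "\<And>x z. x \<in> carrier G - group_center G \<Longrightarrow> z \<in> group_center G \<Longrightarrow>
      \<exists>y \<in> carrier G. x \<otimes> y = z \<otimes> (y \<otimes> x)"
  shows "group_center (G Mod N) = (\<lambda>z. N #> z) ` group_center G"
proof -
  interpret N: normal N G
    using N by (intro subgroup_center_normal) auto
  have comm: "N #> g <#> (N #> x) = N #> x <#> (N #> g) \<longleftrightarrow> x \<otimes> g \<in> N #> (g \<otimes> x)"
    if "x \<in> carrier G" "g \<in> carrier G" for x g
    using that N.rcos_eq_iff[of "x \<otimes> g" "g \<otimes> x"] by (auto simp: N.rcos_sum)
  have "x \<in> group_center G \<longleftrightarrow> (\<forall>g \<in> carrier G. x \<otimes> g \<in> N #> (g \<otimes> x))"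
    if x: "x \<in> carrier G" for x
  proof
    assume "x \<in> group_center G"
    then have "x \<otimes> g = g \<otimes> x" if "g \<in> carrier G" for g
      using that by (simp add: group_center_def)
    then show "\<forall>g \<in> carrier G. x \<otimes> g \<in> N #> (g \<otimes> x)"
      using x rcos_self[OF _ N(1)] by simp
  next
    assume *: "\<forall>g \<in> carrier G. x \<otimes> g \<in> N #> (g \<otimes> x)"
    show "x \<in> group_center G"
    proof (rule ccontr)
      assume "x \<notin> group_center G"
      obtain z where z: "z \<in> group_center G" "z \<notin> N" "z \<in> carrier G"
        using N(2) by (auto simp: group_center_def)
      obtain y where y: "y \<in> carrier G" "x \<otimes> y = z \<otimes> (y \<otimes> x)"
        using camina[of x z] x z(1) \<open>x \<notin> group_center G\<close> by blast
      have "z \<otimes> (y \<otimes> x) \<in> N #> (y \<otimes> x)"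
        using * y by metis
      then have "z \<otimes> (y \<otimes> x) \<otimes> inv (y \<otimes> x) \<in> N"
        using x y(1) by (intro N.rcos_module_imp) (auto intro: is_group)
      then show False
        using x y(1) z(2,3) by (simp add: m_assoc)
    qed
  qed
  then have "N #> x \<in> group_center (G Mod N) \<longleftrightarrow> x \<in> group_center G" if "x \<in> carrier G" for x
    using that by (simp add: group_center_def[of "G Mod N"] carrier_FactGroup comm)
  moreover have "group_center G \<subseteq> carrier G" "group_center (G Mod N) \<subseteq> (\<lambda>x. N #> x) ` carrier G"
    by (auto simp: group_center_def carrier_FactGroup)
  ultimately show ?thesis
    by (force simp: subset_iff)
qed

text \<open>By \<open>camina\<close> no new central elements appear modulo \<open>N\<close>, so the
  centre of the quotient is Z/N, of order \<open>p\<close> by the choice of \<open>N\<close>.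
  Commutators and p-th powers are central already in \<open>G\<close>, which makes the quotient by
  that centre elementary abelian; it is nontrivial because \<open>G\<close> is nonabelian.\<close>

lemma (in group) semi_extraspecialI:
  assumes G: "finite_p_group p G"
    and nonabelian: "group_center G \<noteq> carrier G"
    and comm: "\<And>x y. x \<in> carrier G \<Longrightarrow> y \<in> carrier G \<Longrightarrow>
      \<exists>z \<in> group_center G. x \<otimes> y = z \<otimes> (y \<otimes> x)"
    and pow: "\<And>x. x \<in> carrier G \<Longrightarrow> x [^] p \<in> group_center G"
    and camina: "\<And>x z. x \<in> carrier G - group_center G \<Longrightarrow> z \<in> group_center G \<Longrightarrow>
      \<exists>y \<in> carrier G. x \<otimes> y = z \<otimes> (y \<otimes> x)"
  shows "semi_extraspecial p G"
  unfolding semi_extraspecial_def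
proof (intro conjI allI impI G, elim conjE)
  let ?Z = "group_center G"
  have p: "p > 1" and fin: "finite (carrier G)"
    using G prime_gt_1_nat by (auto simp: finite_p_group_def)
  have ZG: "?Z \<subseteq> carrier G"
    by (auto simp: group_center_def)
  fix N assume N: "subgroup N (G\<lparr>carrier := ?Z\<rparr>)"
    and index: "card (rcosets\<^bsub>G\<lparr>carrier := ?Z\<rparr>\<^esub> N) = p"
  have NZ: "N \<subseteq> ?Z"
    using subgroup.subset[OF N] by simp
  have NG: "subgroup N G"
    using incl_subgroup[OF subgroup_group_center N] .
  interpret N: normal N G
    using NG NZ by (rule subgroup_center_normal)
  have cosets: "rcosets\<^bsub>G\<lparr>carrier := ?Z\<rparr>\<^esub> N = (\<lambda>z. N #> z) ` ?Z"
    by (auto simp: RCOSETS_def r_coset_def)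
  \<comment> \<open>The description of the centre of \<open>G Mod N\<close> asks for a proper
    subgroup \<open>N\<close>; an index \<open>p > 1\<close> excludes equality.\<close>
  have "N \<noteq> ?Z"
  proof
    assume "N = ?Z"
    then have "(\<lambda>z. N #> z) ` ?Z \<subseteq> {N}"
      using coset_join2[OF _ NG] ZG by auto
    then have "card ((\<lambda>z. N #> z) ` ?Z) \<le> 1"
      using card_mono[of "{N}"] by simp
    then show False
      using index p by (simp add: cosets)
  qed
  then have center: "group_center (G Mod N) = (\<lambda>z. N #> z) ` ?Z"
    using NG NZ camina by (intro group_center_FactGroup) auto
  interpret Q: group "G Mod N"
    by (rule N.factorgroup_is_group)
  interpret ZQ: normal "group_center (G Mod N)" "G Mod N"
    by (intro Q.subgroup_center_normal Q.subgroup_group_center order.refl)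
  have Q: "finite_p_group p (G Mod N)"
    using G by (rule N.FactGroup_finite_p_group)
  show "extraspecial p (G Mod N)"
    unfolding extraspecial_def
  proof (intro conjI)
    show "finite_p_group p (G Mod N)"
      by (rule Q)
    show "card (group_center (G Mod N)) = p"
      using index by (simp add: center cosets)
    show "elementary_abelian p (G Mod N Mod group_center (G Mod N))"
    proof (rule ZQ.FactGroup_elementary_abelian[OF Q])
      fix K assume "K \<in> carrier (G Mod N)"
      then obtain x where x: "x \<in> carrier G" "K = N #> x"
        by (auto simp: carrier_FactGroup)
      then show "K [^]\<^bsub>G Mod N\<^esub> p \<in> group_center (G Mod N)"
        using pow by (auto simp: center N.FactGroup_pow)
      fix M assume "M \<in> carrier (G Mod N)"
      then obtain y where y: "y \<in> carrier G" "M = N #> y"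
        by (auto simp: carrier_FactGroup)
      obtain z where z: "z \<in> ?Z" "x \<otimes> y = z \<otimes> (y \<otimes> x)"
        using comm x(1) y(1) by blast
      have "K \<otimes>\<^bsub>G Mod N\<^esub> M = (N #> z) \<otimes>\<^bsub>G Mod N\<^esub> (M \<otimes>\<^bsub>G Mod N\<^esub> K)"
        using z x y ZG by (auto simp: N.rcos_sum)
      then show "K \<otimes>\<^bsub>G Mod N\<^esub> M \<in> group_center (G Mod N) #>\<^bsub>G Mod N\<^esub> (M \<otimes>\<^bsub>G Mod N\<^esub> K)"
        using z(1) by (auto simp: center r_coset_def[of "G Mod N"])
    qed
    have "order (G Mod N Mod group_center (G Mod N)) * card (group_center (G Mod N)) = order (G Mod N)"
      using Q.lagrange[OF Q.subgroup_group_center] by (simp add: FactGroup_def order_def)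
    moreover have "group_center (G Mod N) \<noteq> carrier (G Mod N)"
    proof
      assume *: "group_center (G Mod N) = carrier (G Mod N)"
      have "x \<in> ?Z" if x: "x \<in> carrier G" for x
      proof -
        have "N #> x \<in> (\<lambda>z. N #> z) ` ?Z"
          using * x by (auto simp: center carrier_FactGroup)
        then obtain z where z: "z \<in> ?Z" "N #> x = N #> z"
          by blast
        then have "x \<in> N #> z"
          using x ZG N.rcos_eq_iff by auto
        then show ?thesis
          using z(1) NZ subgroup.m_closed[OF subgroup_group_center] by (auto simp: r_coset_def)
      qed
      then show False
        using nonabelian ZG by blast
    qed
    then have "card (group_center (G Mod N)) \<noteq> order (G Mod N)"
      using Q ZQ.subset by (auto simp: order_def finite_p_group_def dest: card_subset_eq)
    ultimately show "order (G Mod N Mod group_center (G Mod N)) \<noteq> 1"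
      by auto
  qed
qed

text \<open>One noncentral element is enough for the inclusion of the centre: by
  \<open>camina\<close> each central \<open>z\<close> is itself a commutator with it.\<close>

lemma (in group) derived_eq_center:
  assumes nonabelian: "group_center G \<noteq> carrier G"
    and comm: "\<And>x y. x \<in> carrier G \<Longrightarrow> y \<in> carrier G \<Longrightarrow>
      \<exists>z \<in> group_center G. x \<otimes> y = z \<otimes> (y \<otimes> x)"
    and camina: "\<And>x z. x \<in> carrier G - group_center G \<Longrightarrow> z \<in> group_center G \<Longrightarrow>
      \<exists>y \<in> carrier G. x \<otimes> y = z \<otimes> (y \<otimes> x)"
  shows "derived G (carrier G) = group_center G"
proof -
  let ?Z = "group_center G"
  have ZG: "?Z \<subseteq> carrier G"
    by (auto simp: group_center_def)
  have commutator: "x \<otimes> y \<otimes> inv x \<otimes> inv y = z"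
    if "x \<in> carrier G" "y \<in> carrier G" "z \<in> ?Z" "x \<otimes> y = z \<otimes> (y \<otimes> x)" for x y z
    using that ZG by (auto simp: m_assoc)
  show ?thesis
  proof
    have "derived_set G (carrier G) \<subseteq> ?Z"
    proof clarify
      fix x y assume xy: "x \<in> carrier G" "y \<in> carrier G"
      then obtain z where "z \<in> ?Z" "x \<otimes> y = z \<otimes> (y \<otimes> x)"
        using comm by blast
      then show "x \<otimes> y \<otimes> inv x \<otimes> inv y \<in> ?Z"
        using commutator[OF xy] by simp
    qed
    then show "derived G (carrier G) \<subseteq> ?Z"
      unfolding derived_def by (rule generate_subgroup_incl[OF _ subgroup_group_center])
    show "?Z \<subseteq> derived G (carrier G)"
    proof
      fix z assume z: "z \<in> ?Z"
      obtain x where x: "x \<in> carrier G - ?Z"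
        using nonabelian ZG by blast
      then obtain y where y: "y \<in> carrier G" "x \<otimes> y = z \<otimes> (y \<otimes> x)"
        using camina z by blast
      then have "z = x \<otimes> y \<otimes> inv x \<otimes> inv y"
        using commutator[of x y z] x z by simp
      then have "z \<in> derived_set G (carrier G)"
        using x y(1) by blast
      then show "z \<in> derived G (carrier G)"
        unfolding derived_def by (rule generate.incl)
    qed
  qed
qed

text \<open>As G' is the centre Z, the order |Z|^3 means that G' has index |Z|^2, which is the
  square-root condition.\<close>

lemma (in group) ultraspecialI:
  assumes G: "finite_p_group p G"
    and nonabelian: "group_center G \<noteq> carrier G"
    and comm: "\<And>x y. x \<in> carrier G \<Longrightarrow> y \<in> carrier G \<Longrightarrow>
      \<exists>z \<in> group_center G. x \<otimes> y = z \<otimes> (y \<otimes> x)"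
    and pow: "\<And>x. x \<in> carrier G \<Longrightarrow> x [^] p \<in> group_center G"
    and camina: "\<And>x z. x \<in> carrier G - group_center G \<Longrightarrow> z \<in> group_center G \<Longrightarrow>
      \<exists>y \<in> carrier G. x \<otimes> y = z \<otimes> (y \<otimes> x)"
    and order: "order G = card (group_center G) ^ 3"
  shows "ultraspecial p G"
proof -
  let ?Z = "group_center G"
  have "?Z \<noteq> {}" "finite ?Z"
    using G subgroup.one_closed[OF subgroup_group_center]
    by (auto simp: finite_p_group_def group_center_def)
  then have "card ?Z > 0"
    by (simp add: card_gt_0_iff)
  then have "card (rcosets ?Z) = card ?Z ^ 2"
    using lagrange[OF subgroup_group_center] order by (simp add: power2_eq_square power3_eq_cube)
  then have "real (card ?Z) = sqrt (real (card (rcosets ?Z)))"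
    by simp
  then show ?thesis
    using semi_extraspecialI[OF G nonabelian comm pow camina] derived_eq_center[OF nonabelian comm camina]
    by (simp add: ultraspecial_def)
qed

section \<open>Elementary abelian groups\<close>

text \<open>Bezout: \<open>x\<close> is a product of powers of \<open>x [^] k\<close> and
  \<open>x [^] n\<close>.\<close>

lemma (in group) mem_subgroup_of_pow_coprime:
  fixes k n :: int
  assumes "subgroup S G" and "x \<in> carrier G" and "x [^] n \<in> S" and "x [^] k \<in> S" and "coprime k n"
  shows "x \<in> S"
proof -
  obtain u v where "u * k + v * n = 1"
    using bezout_int[of k n] assms(5) by auto
  then have "x = (x [^] k) [^] u \<otimes> (x [^] n) [^] v"
    using assms(2) by (metis int_pow_1 int_pow_mult int_pow_pow mult.commute)
  then show ?thesis
    using assms by (metis subgroup.m_closed group.subgroup_int_pow_closed is_group)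
qed

text \<open>The enlargement step for a subgroup that avoids \<open>S\<close>. If d w^k lies in
  \<open>S\<close>, then w^k lies in \<open>D <#> S\<close>; an exponent k prime to \<open>p\<close>
  would put \<open>w\<close> there as well. So \<open>p\<close> divides k, w^k is trivial, and the
  element lies in both \<open>D\<close> and \<open>S\<close>.\<close>

lemma (in comm_group) inter_subgroup_generate_eq_one:
  assumes "Factorial_Ring.prime (p::nat)" and D: "subgroup D G" and S: "subgroup S G"
    and DS: "D \<inter> S = {\<one>}" and w: "w \<in> carrier G" "w [^] p = \<one>" "w \<notin> D <#> S"
  shows "(D <#> generate G {w}) \<inter> S = {\<one>}"
proof -
  have "x = \<one>" if x': "x \<in> D <#> generate G {w}" and x: "x \<in> S" for x
  proof -
    obtain d and k :: int where d: "d \<in> D" "x = d \<otimes> w [^] k"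
      using x' generate_pow[OF w(1)] by (auto simp: set_mult_def)
    have dG: "d \<in> carrier G" and xG: "x \<in> carrier G"
      using d(1) x subgroup.subset D S by blast+
    interpret DS: subgroup "D <#> S" G
      using D S by (rule mult_subgroups)
    have "w [^] k = inv d \<otimes> x"
      using d(2) dG xG w(1) by (simp add: inv_solve_left)
    then have wk: "w [^] k \<in> D <#> S"
      using d(1) x subgroup.m_inv_closed[OF D] by (auto simp: set_mult_def)
    have "w [^] int p \<in> D <#> S"
      using w(2) by (simp add: int_pow_int)
    then have "\<not> coprime k (int p)"
      using mem_subgroup_of_pow_coprime[OF DS.subgroup_axioms w(1) _ wk, of "int p"] w(3) by blast
    then have "int p dvd k"
      using assms(1) by (metis coprime_commute prime_imp_coprime prime_nat_int_transfer)
    then obtain m where "k = int p * m"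
      by (elim dvdE)
    then have "w [^] k = \<one>"
      using w by (metis int_pow_int int_pow_one int_pow_pow)
    then have "x \<in> D"
      using d dG by simp
    then show ?thesis
      using x DS by blast
  qed
  then show ?thesis
    using subgroup.one_closed[OF S]
      subgroup.one_closed[OF mult_subgroups[OF D generate_is_subgroup[of "{w}"]]] w(1)
    by blast
qed

text \<open>Stands in for bases and dimensions. For a single \<open>S\<close> it yields a complement
  of \<open>S\<close> containing \<open>D\<close>; for the two axes of a direct product it yields
  the graph of an isomorphism between subgroups that cannot be extended. An element \<open>w\<close>
  outside all the products could be adjoined to \<open>E\<close>, against maximality.\<close>

lemma (in comm_group) maximal_subgroup_avoiding:
  assumes p: "Factorial_Ring.prime (p::nat)" and fin: "finite (carrier G)"
    and pow: "\<And>x. x \<in> carrier G \<Longrightarrow> x [^] p = \<one>"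
    and D: "subgroup D G"
    and SS: "SS \<noteq> {}" "\<And>S. S \<in> SS \<Longrightarrow> subgroup S G" "\<And>S. S \<in> SS \<Longrightarrow> D \<inter> S = {\<one>}"
  obtains E where "subgroup E G" "D \<subseteq> E" "\<And>S. S \<in> SS \<Longrightarrow> E \<inter> S = {\<one>}"
    "\<And>w. w \<in> carrier G \<Longrightarrow> \<exists>S \<in> SS. w \<in> E <#> S"
proof -
  define A where "A = {E. subgroup E G \<and> (\<forall>S \<in> SS. E \<inter> S = {\<one>})}"
  have "A \<subseteq> Pow (carrier G)"
    by (auto simp: A_def dest: subgroup.subset)
  then have "finite A"
    using fin finite_subset by blast
  moreover have "D \<in> A"
    using D SS by (simp add: A_def)
  ultimately obtain E where E: "E \<in> A" "D \<subseteq> E" and max: "\<And>E'. E' \<in> A \<Longrightarrow> E \<subseteq> E' \<Longrightarrow> E = E'"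
    by (metis finite_has_maximal2)
  have sub: "subgroup E G" and avoid: "\<And>S. S \<in> SS \<Longrightarrow> E \<inter> S = {\<one>}"
    using E(1) by (auto simp: A_def)
  have "\<exists>S \<in> SS. w \<in> E <#> S" if w: "w \<in> carrier G" for w
  proof (rule ccontr)
    assume "\<not> (\<exists>S \<in> SS. w \<in> E <#> S)"
    then have nmem: "w \<notin> E <#> S" if "S \<in> SS" for S
      using that by blast
    let ?E = "E <#> generate G {w}"
    have gen: "subgroup (generate G {w}) G"
      using w by (intro generate_is_subgroup) auto
    have "?E \<in> A"
      using p sub SS(2) avoid w pow nmem mult_subgroups[OF sub gen]
      by (auto simp: A_def inter_subgroup_generate_eq_one)
    moreover have "E \<subseteq> ?E"
      using subgroup.one_closed[OF gen] subgroup.mem_carrier[OF sub]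
      by (force simp: set_mult_def)
    ultimately have "E = ?E"
      by (rule max)
    moreover have "w \<in> ?E"
      using subgroup.one_closed[OF sub] generate.incl[of w "{w}" G] w
      by (force simp: set_mult_def)
    moreover obtain S where "S \<in> SS"
      using SS(1) by blast
    ultimately have "w \<in> E <#> S"
      using subgroup.one_closed[OF SS(2)[OF \<open>S \<in> SS\<close>]] w by (force simp: set_mult_def)
    then show False
      using nmem \<open>S \<in> SS\<close> by blast
  qed
  then show thesis
    using that sub E(2) avoid by blast
qed

section \<open>Homomorphisms and retractions as subgroups of direct products\<close>

lemma inj_on_fst_subgroup:
  assumes "group V" and "group A" and D: "subgroup D (V \<times>\<times> A)"
    and triv: "D \<inter> ({\<one>\<^bsub>V\<^esub>} \<times> carrier A) = {\<one>\<^bsub>V \<times>\<times> A\<^esub>}"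
  shows "inj_on fst D"
proof -
  have "group_hom (V \<times>\<times> A) V fst"
    using assms(1,2) by (auto simp: group_hom_def group_hom_axioms_def hom_def DirProd_group)
  moreover have "kernel ((V \<times>\<times> A)\<lparr>carrier := D\<rparr>) V fst = D \<inter> ({\<one>\<^bsub>V\<^esub>} \<times> carrier A)"
    using subgroup.subset[OF D] by (auto simp: kernel_def)
  ultimately show ?thesis
    using group_hom.inj_on_subgroup_iff_trivial_ker[OF _ D] triv by metis
qed

lemma inj_on_snd_subgroup:
  assumes "group V" and "group A" and D: "subgroup D (V \<times>\<times> A)"
    and triv: "D \<inter> (carrier V \<times> {\<one>\<^bsub>A\<^esub>}) = {\<one>\<^bsub>V \<times>\<times> A\<^esub>}"
  shows "inj_on snd D"
proof -
  have "group_hom (V \<times>\<times> A) A snd"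
    using assms(1,2) by (auto simp: group_hom_def group_hom_axioms_def hom_def DirProd_group)
  moreover have "kernel ((V \<times>\<times> A)\<lparr>carrier := D\<rparr>) A snd = D \<inter> (carrier V \<times> {\<one>\<^bsub>A\<^esub>})"
    using subgroup.subset[OF D] by (auto simp: kernel_def)
  ultimately show ?thesis
    using group_hom.inj_on_subgroup_iff_trivial_ker[OF _ D] triv by metis
qed

text \<open>Turns the maximal subgroups of \<open>V \<times>\<times> A\<close> and
  \<open>A \<times>\<times> V\<close> into the embedding and the retraction: by \<open>fn\<close>
  the relation \<open>D\<close> is single-valued, and being a subgroup it is multiplicative.\<close>

lemma hom_of_graph:
  assumes "group V" and "group A" and D: "subgroup D (V \<times>\<times> A)"
    and fn: "D \<inter> ({\<one>\<^bsub>V\<^esub>} \<times> carrier A) = {\<one>\<^bsub>V \<times>\<times> A\<^esub>}"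
    and total: "\<And>v. v \<in> carrier V \<Longrightarrow> \<exists>a. (v, a) \<in> D"
  obtains f where "f \<in> hom V A" and "\<And>v a. v \<in> carrier V \<Longrightarrow> (v, a) \<in> D \<longleftrightarrow> a = f v"
proof -
  interpret V: group V by fact
  interpret A: group A by fact
  interpret D: subgroup D "V \<times>\<times> A" by fact
  have uniq: "a = b" if "(v, a) \<in> D" "(v, b) \<in> D" for v a b
    using inj_onD[OF inj_on_fst_subgroup[OF assms(1,2) D fn] _ that] by simp
  define f where "f v = (SOME a. (v, a) \<in> D)" for v
  have f: "(v, f v) \<in> D" if "v \<in> carrier V" for v
    unfolding f_def using total[OF that] by (rule someI_ex)
  show thesis
  proof
    show "f \<in> hom V A"
    proof (rule homI)
      fix v w assume vw: "v \<in> carrier V" "w \<in> carrier V"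
      have "(v, f v) \<otimes>\<^bsub>V \<times>\<times> A\<^esub> (w, f w) \<in> D"
        using f vw by (intro D.m_closed) auto
      then have "(v \<otimes>\<^bsub>V\<^esub> w, f v \<otimes>\<^bsub>A\<^esub> f w) \<in> D"
        by simp
      then show "f (v \<otimes>\<^bsub>V\<^esub> w) = f v \<otimes>\<^bsub>A\<^esub> f w"
        using uniq f vw by blast
    qed (use f D.subset in auto)
    show "(v, a) \<in> D \<longleftrightarrow> a = f v" if "v \<in> carrier V" for v a
      using uniq f that by blast
  qed
qed

lemma elementary_abelian_DirProd:
  assumes "elementary_abelian p V" and "elementary_abelian p A"
  shows "comm_group (V \<times>\<times> A)" and "finite (carrier (V \<times>\<times> A))"
    and "\<And>x. x \<in> carrier (V \<times>\<times> A) \<Longrightarrow> x [^]\<^bsub>V \<times>\<times> A\<^esub> p = \<one>\<^bsub>V \<times>\<times> A\<^esub>"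
proof -
  interpret V: comm_group V
    using assms(1) by (simp add: elementary_abelian_def)
  interpret A: comm_group A
    using assms(2) by (simp add: elementary_abelian_def)
  interpret VA: group "V \<times>\<times> A"
    by (intro DirProd_group V.is_group A.is_group)
  show "comm_group (V \<times>\<times> A)"
    by (intro VA.group_comm_groupI) (auto simp: V.m_comm A.m_comm)
  show "finite (carrier (V \<times>\<times> A))"
    using assms by (simp add: elementary_abelian_def finite_p_group_def)
  have "(x, y) [^]\<^bsub>V \<times>\<times> A\<^esub> n = (x [^]\<^bsub>V\<^esub> n, y [^]\<^bsub>A\<^esub> n)" for x y and n :: nat
    by (induction n) auto
  then show "x [^]\<^bsub>V \<times>\<times> A\<^esub> p = \<one>\<^bsub>V \<times>\<times> A\<^esub>" if "x \<in> carrier (V \<times>\<times> A)" for x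
    using that assms by (auto simp: elementary_abelian_def)
qed

text \<open>Both maps arise as graphs. A subgroup of \<open>V \<times>\<times> A\<close> that is
  maximal among those meeting both axes trivially is a partial isomorphism, and comparing orders
  forces its domain to be all of \<open>V\<close>. Its transpose in
  \<open>A \<times>\<times> V\<close> extends to a complement of the axis \<open>V\<close>, which is
  the graph of a left inverse.\<close>

lemma elementary_abelian_retract:
  assumes V: "elementary_abelian p V" and A: "elementary_abelian p A" and le: "order V \<le> order A"
  obtains i r where "i \<in> hom V A" and "r \<in> hom A V" and "\<And>v. v \<in> carrier V \<Longrightarrow> r (i v) = v"
proof -
  interpret V: comm_group V
    using V by (simp add: elementary_abelian_def)
  interpret A: comm_group A
    using A by (simp add: elementary_abelian_def)
  interpret VA: comm_group "V \<times>\<times> A"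
    by (rule elementary_abelian_DirProd[OF V A])
  interpret AV: comm_group "A \<times>\<times> V"
    by (rule elementary_abelian_DirProd[OF A V])
  have p: "Factorial_Ring.prime p" and finV: "finite (carrier V)" and finA: "finite (carrier A)"
    using V A by (auto simp: elementary_abelian_def finite_p_group_def)
  have left: "subgroup ({\<one>\<^bsub>V\<^esub>} \<times> carrier A) (V \<times>\<times> A)"
    by (intro DirProd_subgroups V.triv_subgroup A.subgroup_self V.is_group A.is_group)
  have right: "subgroup (carrier V \<times> {\<one>\<^bsub>A\<^esub>}) (V \<times>\<times> A)"
    by (intro DirProd_subgroups V.subgroup_self A.triv_subgroup V.is_group A.is_group)
  have left': "subgroup ({\<one>\<^bsub>A\<^esub>} \<times> carrier V) (A \<times>\<times> V)"
    by (intro DirProd_subgroups A.triv_subgroup V.subgroup_self V.is_group A.is_group)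
  obtain D where D: "subgroup D (V \<times>\<times> A)"
    and fn: "D \<inter> ({\<one>\<^bsub>V\<^esub>} \<times> carrier A) = {\<one>\<^bsub>V \<times>\<times> A\<^esub>}"
    and inj: "D \<inter> (carrier V \<times> {\<one>\<^bsub>A\<^esub>}) = {\<one>\<^bsub>V \<times>\<times> A\<^esub>}"
    and max: "\<And>w. w \<in> carrier (V \<times>\<times> A) \<Longrightarrow>
      w \<in> D <#>\<^bsub>V \<times>\<times> A\<^esub> ({\<one>\<^bsub>V\<^esub>} \<times> carrier A) \<or> w \<in> D <#>\<^bsub>V \<times>\<times> A\<^esub> (carrier V \<times> {\<one>\<^bsub>A\<^esub>})"
    by (rule VA.maximal_subgroup_avoiding[OF p elementary_abelian_DirProd(2,3)[OF V A] VA.triv_subgroup,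
          of "{{\<one>\<^bsub>V\<^esub>} \<times> carrier A, carrier V \<times> {\<one>\<^bsub>A\<^esub>}}"])
      (use left right in auto)
  interpret D: subgroup D "V \<times>\<times> A" by (rule D)
  \<comment> \<open>Multiplying \<open>D\<close> by an axis frees one coordinate, so by maximality
    each pair has its first entry in the domain or its second entry in the image of the partial
    isomorphism.\<close>
  have cases: "v \<in> fst ` D \<or> a \<in> snd ` D" if "v \<in> carrier V" "a \<in> carrier A" for v a
    using max[of "(v, a)"] that D.subset by (force simp: set_mult_def)
  note inj_fst = inj_on_fst_subgroup[OF V.is_group A.is_group D fn]
  note inj_snd = inj_on_snd_subgroup[OF V.is_group A.is_group D inj]
  have "fst ` D = carrier V"
  proof (rule ccontr)
    assume *: "fst ` D \<noteq> carrier V"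
    have sub: "fst ` D \<subseteq> carrier V" "snd ` D \<subseteq> carrier A"
      using D.subset by auto
    \<comment> \<open>Some element of \<open>V\<close> lies outside the domain, so every element of
      \<open>A\<close> lies in the image. Both projections are injective on \<open>D\<close>, whence
      |A| = |D| < |V|.\<close>
    then have "snd ` D = carrier A"
      using * cases by blast
    then have "order A = card (fst ` D)"
      by (simp add: order_def card_image inj_fst inj_snd flip: card_image[OF inj_snd])
    also have "\<dots> < order V"
      unfolding order_def using sub * finV by (intro psubset_card_mono) auto
    finally show False
      using le by simp
  qed
  then have "\<exists>a. (v, a) \<in> D" if "v \<in> carrier V" for v
    using that by force
  then obtain i where i: "i \<in> hom V A" and D_i: "\<And>v a. v \<in> carrier V \<Longrightarrow> (v, a) \<in> D \<longleftrightarrow> a = i v"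
    using hom_of_graph[OF V.is_group A.is_group D fn] by blast
  have i_one: "v = \<one>\<^bsub>V\<^esub>" if "v \<in> carrier V" "i v = \<one>\<^bsub>A\<^esub>" for v
    using inj that D_i by fastforce
  define D0 where "D0 = (\<lambda>v. (i v, v)) ` carrier V"
  have "(\<lambda>v. (i v, v)) \<in> hom V (A \<times>\<times> V)"
    using i by (auto simp: hom_def)
  then interpret d: group_hom V "A \<times>\<times> V" "\<lambda>v. (i v, v)"
    by (simp add: group_hom_def group_hom_axioms_def AV.is_group V.is_group)
  have D0: "subgroup D0 (A \<times>\<times> V)"
    unfolding D0_def by (rule d.img_is_subgroup)
  have "D0 \<inter> ({\<one>\<^bsub>A\<^esub>} \<times> carrier V) = {\<one>\<^bsub>A \<times>\<times> V\<^esub>}"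
    using subgroup.one_closed[OF D0] i_one by (auto simp: D0_def)
  \<comment> \<open>A complement of the second axis is total and single-valued over
    \<open>A\<close>; containing \<open>D0\<close>, it extends the inverse of
    \<open>i\<close>.\<close>
  then obtain E where E: "subgroup E (A \<times>\<times> V)" "D0 \<subseteq> E"
    "E \<inter> ({\<one>\<^bsub>A\<^esub>} \<times> carrier V) = {\<one>\<^bsub>A \<times>\<times> V\<^esub>}"
    and E_max: "\<And>w. w \<in> carrier (A \<times>\<times> V) \<Longrightarrow> w \<in> E <#>\<^bsub>A \<times>\<times> V\<^esub> ({\<one>\<^bsub>A\<^esub>} \<times> carrier V)"
    by (rule_tac AV.maximal_subgroup_avoiding[OF p elementary_abelian_DirProd(2,3)[OF A V] D0,
          of "{{\<one>\<^bsub>A\<^esub>} \<times> carrier V}"])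
      (use left' in auto)
  have "\<exists>v. (a, v) \<in> E" if "a \<in> carrier A" for a
    using E_max[of "(a, \<one>\<^bsub>V\<^esub>)"] that subgroup.subset[OF E(1)] by (force simp: set_mult_def)
  then obtain r where r: "r \<in> hom A V" and E_r: "\<And>a v. a \<in> carrier A \<Longrightarrow> (a, v) \<in> E \<longleftrightarrow> v = r a"
    using hom_of_graph[OF A.is_group V.is_group E(1,3)] by blast
  have "r (i v) = v" if "v \<in> carrier V" for v
  proof -
    have "i v \<in> carrier A" "(i v, v) \<in> E"
      using that i E(2) by (auto simp: D0_def hom_in_carrier)
    then show ?thesis
      using E_r by simp
  qed
  then show thesis
    using that i r by blast
qed

text \<open>Cauchy's theorem, as a case of Sylow's, excludes any other prime \<open>q\<close>: in a
  subgroup of order \<open>q\<close> the q-th and p-th powers of each element are trivial, hence so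
  is the element.\<close>

lemma (in comm_group) elementary_abelianI:
  assumes p: "Factorial_Ring.prime (p::nat)" and fin: "finite (carrier G)"
    and pow: "\<And>x. x \<in> carrier G \<Longrightarrow> x [^] p = \<one>"
  shows "elementary_abelian p G"
proof -
  have "q = p" if q: "Factorial_Ring.prime q" "q dvd order G" for q
  proof (rule ccontr)
    assume "q \<noteq> p"
    obtain m where "order G = q ^ 1 * m"
      using q(2) by (auto elim: dvdE)
    then obtain S where S: "subgroup S G" "card S = q"
      using sylow_thm[OF q(1) is_group _ fin, of 1 m] by auto
    interpret S: group "G\<lparr>carrier := S\<rparr>"
      using S(1) by (rule subgroup_imp_group)
    have "x = \<one>" if x: "x \<in> S" for x
    proof -
      have xG: "x \<in> carrier G"
        using x S(1) subgroup.mem_carrier by metis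
      have "x [^]\<^bsub>G\<lparr>carrier := S\<rparr>\<^esub> q = \<one>"
        using S.pow_order_eq_1[of x] x S(2) by (simp add: order_def)
      then have "x [^] int q = \<one>" "x [^] int p = \<one>"
        using pow[OF xG] nat_pow_consistent[of x q S] by (simp_all add: int_pow_int)
      moreover have "coprime (int q) (int p)"
        using primes_coprime[OF q(1) p] \<open>q \<noteq> p\<close> by simp
      ultimately show ?thesis
        using mem_subgroup_of_pow_coprime[OF triv_subgroup xG, of "int p" "int q"] by simp
    qed
    then have "card S \<le> card {\<one>}"
      by (intro card_mono) auto
    then show False
      using S(2) prime_gt_1_nat[OF q(1)] by simp
  qed
  then have "prime_factors (order G) \<subseteq> {p}"
    by (auto simp: in_prime_factors_iff)
  moreover have "order G \<noteq> 0"
    using fin order_gt_0_iff_finite by simp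
  \<comment> \<open>An empty set of prime factors means order one, the zeroth power of
    \<open>p\<close>.\<close>
  ultimately have order: "order G = p ^ multiplicity p (order G)"
    using prime_factorization_nat[of "order G"]
    by (cases "prime_factors (order G) = {}") (auto simp: subset_singleton_iff)
  show ?thesis
    unfolding elementary_abelian_def finite_p_group_def
    using p fin pow is_group comm_group_axioms exI[of _ "multiplicity p (order G)"] order by blast
qed

section \<open>Cocycles of central extensions\<close>

text \<open>Coordinates for \<open>G\<close>: \<open>\<pi>\<close> records an element modulo
  \<open>C\<close> and \<open>\<kappa>\<close> its component in \<open>C\<close>, both inside
  \<open>A\<close>, so that \<open>G\<close> embeds into the extension of \<open>A\<close> by
  \<open>A\<close> with cocycle \<open>t\<close>. The retraction \<open>r\<close> lets a cocycle
  that lives on \<open>G Mod C\<close> be evaluated on all of \<open>A\<close>.\<close>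

lemma (in group) central_extension_cocycle:
  assumes C: "subgroup C G" "C \<subseteq> group_center G" and A: "comm_group A"
    and i: "i \<in> hom (G Mod C) A" and r: "r \<in> hom A (G Mod C)"
    and ri: "\<And>v. v \<in> carrier (G Mod C) \<Longrightarrow> r (i v) = v"
    and j: "j \<in> hom (G\<lparr>carrier := C\<rparr>) A" "inj_on j C"
  obtains t \<pi> \<kappa> where
    "\<And>a b. a \<in> carrier A \<Longrightarrow> b \<in> carrier A \<Longrightarrow> t a b \<in> carrier A"
    "\<And>a. a \<in> carrier A \<Longrightarrow> t \<one>\<^bsub>A\<^esub> a = \<one>\<^bsub>A\<^esub>" "\<And>a. a \<in> carrier A \<Longrightarrow> t a \<one>\<^bsub>A\<^esub> = \<one>\<^bsub>A\<^esub>"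
    "\<And>a b c. a \<in> carrier A \<Longrightarrow> b \<in> carrier A \<Longrightarrow> c \<in> carrier A \<Longrightarrow>
      t a b \<otimes>\<^bsub>A\<^esub> t (a \<otimes>\<^bsub>A\<^esub> b) c = t a (b \<otimes>\<^bsub>A\<^esub> c) \<otimes>\<^bsub>A\<^esub> t b c"
    "\<pi> \<in> hom G A" "\<And>x. x \<in> carrier G \<Longrightarrow> \<kappa> x \<in> carrier A"
    "\<And>x y. x \<in> carrier G \<Longrightarrow> y \<in> carrier G \<Longrightarrow>
      \<kappa> (x \<otimes> y) = \<kappa> x \<otimes>\<^bsub>A\<^esub> \<kappa> y \<otimes>\<^bsub>A\<^esub> t (\<pi> x) (\<pi> y)"
    "inj_on (\<lambda>x. (\<pi> x, \<kappa> x)) (carrier G)"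
proof -
  interpret C: normal C G
    using C by (rule subgroup_center_normal)
  interpret A: comm_group A by (rule A)
  interpret Q: group "G Mod C" by (rule C.factorgroup_is_group)
  interpret GC: group "G\<lparr>carrier := C\<rparr>"
    using C(1) by (rule subgroup_imp_group)
  interpret i: group_hom "G Mod C" A i
    using i by (simp add: group_hom_def group_hom_axioms_def Q.is_group A.is_group)
  interpret r: group_hom A "G Mod C" r
    using r by (simp add: group_hom_def group_hom_axioms_def Q.is_group A.is_group)
  interpret j: group_hom "G\<lparr>carrier := C\<rparr>" A j
    using j(1) by (simp add: group_hom_def group_hom_axioms_def GC.is_group A.is_group)
  have central: "c \<otimes> x = x \<otimes> c" if "c \<in> C" "x \<in> carrier G" for c x
    using that C(2) by (auto simp: group_center_def)
  \<comment> \<open>a section of \<open>G \<rightarrow> G Mod C\<close>, pulled back along \<open>r\<close>; the value \<open>\<one>\<close> on the kernel of \<open>r\<close>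
    normalises the cocycle\<close>
  define s where "s a = (if r a = C then \<one> else SOME x. x \<in> carrier G \<and> r a = C #> x)" for a
  have s: "s a \<in> carrier G" "r a = C #> s a" if "a \<in> carrier A" for a
  proof -
    have "r a \<in> carrier (G Mod C)"
      using that by (rule r.hom_closed)
    then have "\<exists>x. x \<in> carrier G \<and> r a = C #> x"
      by (auto simp: carrier_FactGroup)
    then have "s a \<in> carrier G \<and> r a = C #> s a"
      using someI_ex[of "\<lambda>x. x \<in> carrier G \<and> r a = C #> x"] coset_mult_one[OF C.subset]
      by (simp add: s_def)
    then show "s a \<in> carrier G" "r a = C #> s a"
      by auto
  qed
  have s_one: "s \<one>\<^bsub>A\<^esub> = \<one>"
    using r.hom_one by (simp add: s_def)
  \<comment> \<open>The factor set of \<open>s\<close>: its failure to be multiplicative.\<close>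
  define c where "c a b = s a \<otimes> s b \<otimes> inv (s (a \<otimes>\<^bsub>A\<^esub> b))" for a b
  have c: "c a b \<in> C" if ab: "a \<in> carrier A" "b \<in> carrier A" for a b
  proof -
    have "C #> (s a \<otimes> s b) = r a \<otimes>\<^bsub>G Mod C\<^esub> r b"
      using s ab by (simp add: C.rcos_sum)
    also have "\<dots> = C #> s (a \<otimes>\<^bsub>A\<^esub> b)"
      using s(2)[of "a \<otimes>\<^bsub>A\<^esub> b"] r.hom_mult[of a b] ab by simp
    finally have "s a \<otimes> s b \<in> C #> s (a \<otimes>\<^bsub>A\<^esub> b)"
      using s(1) ab by (simp flip: C.rcos_eq_iff)
    then show ?thesis
      unfolding c_def using s(1) ab by (intro C.rcos_module_imp is_group) auto
  qed
  note cG = C.mem_carrier[OF c]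
  have s_mult: "s a \<otimes> s b = c a b \<otimes> s (a \<otimes>\<^bsub>A\<^esub> b)" if "a \<in> carrier A" "b \<in> carrier A" for a b
    using that s(1) by (simp add: c_def m_assoc)
  \<comment> \<open>Associativity: a product of three values of \<open>s\<close> is reduced in two
    ways, and centrality of \<open>C\<close> allows the factors to be collected on the left.\<close>
  have cocycle: "c a b \<otimes> c (a \<otimes>\<^bsub>A\<^esub> b) d = c a (b \<otimes>\<^bsub>A\<^esub> d) \<otimes> c b d"
    if abd: "a \<in> carrier A" "b \<in> carrier A" "d \<in> carrier A" for a b d
  proof -
    have "c a b \<otimes> c (a \<otimes>\<^bsub>A\<^esub> b) d \<otimes> s (a \<otimes>\<^bsub>A\<^esub> b \<otimes>\<^bsub>A\<^esub> d) = s a \<otimes> s b \<otimes> s d"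
      using abd s(1) cG by (simp add: s_mult m_assoc)
    also have "\<dots> = s a \<otimes> (c b d \<otimes> s (b \<otimes>\<^bsub>A\<^esub> d))"
      using abd s(1) by (simp add: m_assoc flip: s_mult)
    also have "\<dots> = c b d \<otimes> (s a \<otimes> s (b \<otimes>\<^bsub>A\<^esub> d))"
      using abd s(1) cG central[OF c, of b d "s a"] by (simp add: m_assoc[symmetric])
    also have "\<dots> = c b d \<otimes> c a (b \<otimes>\<^bsub>A\<^esub> d) \<otimes> s (a \<otimes>\<^bsub>A\<^esub> b \<otimes>\<^bsub>A\<^esub> d)"
      using abd s(1) cG by (simp add: s_mult m_assoc A.m_assoc)
    finally have "c a b \<otimes> c (a \<otimes>\<^bsub>A\<^esub> b) d = c b d \<otimes> c a (b \<otimes>\<^bsub>A\<^esub> d)"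
      using abd s(1) cG by simp
    then show ?thesis
      using central[OF c cG, of b d a "b \<otimes>\<^bsub>A\<^esub> d"] abd by simp
  qed
  define \<pi> where "\<pi> x = i (C #> x)" for x
  have \<pi>_closed: "\<pi> x \<in> carrier A" if "x \<in> carrier G" for x
    using that by (auto simp: \<pi>_def carrier_FactGroup)
  have \<pi>_mult: "\<pi> (x \<otimes> y) = \<pi> x \<otimes>\<^bsub>A\<^esub> \<pi> y" if "x \<in> carrier G" "y \<in> carrier G" for x y
    using that i.hom_mult[of "C #> x" "C #> y"] by (simp add: \<pi>_def carrier_FactGroup C.rcos_sum)
  \<comment> \<open>By \<open>ri\<close> the element \<open>s (\<pi> x)\<close> represents the coset
    of \<open>x\<close>, so \<open>k x\<close> is the component of \<open>x\<close> in
    \<open>C\<close>.\<close>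
  define k where "k x = x \<otimes> inv (s (\<pi> x))" for x
  have k: "k x \<in> C" if x: "x \<in> carrier G" for x
  proof -
    have "C #> x = C #> s (\<pi> x)"
      using x s(2)[OF \<pi>_closed[OF x]] ri[of "C #> x"] by (simp add: \<pi>_def carrier_FactGroup)
    then have "x \<in> C #> s (\<pi> x)"
      using x s(1) \<pi>_closed by (simp flip: C.rcos_eq_iff)
    then show ?thesis
      unfolding k_def using s(1) x \<pi>_closed by (intro C.rcos_module_imp is_group) auto
  qed
  note kG = C.mem_carrier[OF k]
  have k_s: "k x \<otimes> s (\<pi> x) = x" if "x \<in> carrier G" for x
    using that s(1) \<pi>_closed by (simp add: k_def m_assoc)
  have k_mult: "k (x \<otimes> y) = k x \<otimes> k y \<otimes> c (\<pi> x) (\<pi> y)" if xy: "x \<in> carrier G" "y \<in> carrier G" for x y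
  proof -
    note closed = xy s(1) \<pi>_closed kG cG
    have "k (x \<otimes> y) \<otimes> s (\<pi> x \<otimes>\<^bsub>A\<^esub> \<pi> y) = (k x \<otimes> s (\<pi> x)) \<otimes> (k y \<otimes> s (\<pi> y))"
      using xy k_s[of "x \<otimes> y"] by (simp add: k_s \<pi>_mult)
    also have "\<dots> = k x \<otimes> (s (\<pi> x) \<otimes> k y) \<otimes> s (\<pi> y)"
      using closed by (simp add: m_assoc)
    also have "s (\<pi> x) \<otimes> k y = k y \<otimes> s (\<pi> x)"
      using central[OF k, of y "s (\<pi> x)"] closed by simp
    also have "k x \<otimes> (k y \<otimes> s (\<pi> x)) \<otimes> s (\<pi> y) = k x \<otimes> k y \<otimes> (s (\<pi> x) \<otimes> s (\<pi> y))"
      using closed by (simp add: m_assoc)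
    also have "\<dots> = k x \<otimes> k y \<otimes> c (\<pi> x) (\<pi> y) \<otimes> s (\<pi> x \<otimes>\<^bsub>A\<^esub> \<pi> y)"
      using closed by (simp add: m_assoc s_mult)
    finally show ?thesis
      using closed by simp
  qed
  have j_mult: "j (x \<otimes> y) = j x \<otimes>\<^bsub>A\<^esub> j y" if "x \<in> C" "y \<in> C" for x y
    using that j.hom_mult[of x y] by simp
  have j_closed: "j x \<in> carrier A" if "x \<in> C" for x
    using that j.hom_closed[of x] by simp
  have j_one: "j \<one> = \<one>\<^bsub>A\<^esub>"
    using j.hom_one by simp
  show thesis
  proof (rule that[of "\<lambda>a b. j (c a b)" \<pi> "\<lambda>x. j (k x)"])
    show "j (c a b) \<in> carrier A" if "a \<in> carrier A" "b \<in> carrier A" for a b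
      using that c j_closed by simp
    show "j (c \<one>\<^bsub>A\<^esub> a) = \<one>\<^bsub>A\<^esub>" "j (c a \<one>\<^bsub>A\<^esub>) = \<one>\<^bsub>A\<^esub>" if "a \<in> carrier A" for a
      using that s(1) by (simp_all add: c_def s_one j_one)
    show "j (c a b) \<otimes>\<^bsub>A\<^esub> j (c (a \<otimes>\<^bsub>A\<^esub> b) d) = j (c a (b \<otimes>\<^bsub>A\<^esub> d)) \<otimes>\<^bsub>A\<^esub> j (c b d)"
      if "a \<in> carrier A" "b \<in> carrier A" "d \<in> carrier A" for a b d
      using that cocycle[of a b d] c by (simp flip: j_mult)
    show "\<pi> \<in> hom G A"
      using \<pi>_closed \<pi>_mult by (auto simp: hom_def)
    show "j (k x) \<in> carrier A" if "x \<in> carrier G" for x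
      using that k j_closed by simp
    show "j (k (x \<otimes> y)) = j (k x) \<otimes>\<^bsub>A\<^esub> j (k y) \<otimes>\<^bsub>A\<^esub> j (c (\<pi> x) (\<pi> y))"
      if "x \<in> carrier G" "y \<in> carrier G" for x y
      using that k c \<pi>_closed C.m_closed by (simp add: k_mult j_mult)
    show "inj_on (\<lambda>x. (\<pi> x, j (k x))) (carrier G)"
    proof (rule inj_onI)
      fix x y assume xy: "x \<in> carrier G" "y \<in> carrier G" "(\<pi> x, j (k x)) = (\<pi> y, j (k y))"
      then have "k x = k y"
        using inj_onD[OF j(2)] k by simp
      then show "x = y"
        using xy k_s by (metis Pair_inject)
    qed
  qed
qed

section \<open>Heisenberg groups twisted by a cocycle\<close>

text \<open>The injection \<open>enc\<close> moves the triples to an arbitrary type of group elements.\<close>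
definition twisted_heisenberg ::
  "('f, 'm) ring_scheme \<Rightarrow> ('f \<Rightarrow> 'f \<Rightarrow> 'f) \<Rightarrow> ('f \<times> 'f \<times> 'f \<Rightarrow> 'g) \<Rightarrow> 'g monoid" where
  "twisted_heisenberg F t enc =
    \<lparr>carrier = enc ` (carrier F \<times> carrier F \<times> carrier F),
     monoid.mult = (\<lambda>u v. case (inv_into UNIV enc u, inv_into UNIV enc v) of ((a, b, c), (a', b', c')) \<Rightarrow>
       enc (a \<oplus>\<^bsub>F\<^esub> a', b \<oplus>\<^bsub>F\<^esub> b', c \<oplus>\<^bsub>F\<^esub> c' \<oplus>\<^bsub>F\<^esub> (a \<otimes>\<^bsub>F\<^esub> b' \<oplus>\<^bsub>F\<^esub> t b b'))),
     one = enc (\<zero>\<^bsub>F\<^esub>, \<zero>\<^bsub>F\<^esub>, \<zero>\<^bsub>F\<^esub>)\<rparr>"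

text \<open>The cocycle identity is what associativity of the triples requires. Normalisation makes
  the zero triple neutral and hides \<open>t\<close> from any product in which one of the second
  coordinates is zero.\<close>

locale additive_cocycle = field F for F (structure) +
  fixes t :: "'a \<Rightarrow> 'a \<Rightarrow> 'a" and enc :: "'a \<times> 'a \<times> 'a \<Rightarrow> 'g"
  assumes t_closed [simp]: "a \<in> carrier F \<Longrightarrow> b \<in> carrier F \<Longrightarrow> t a b \<in> carrier F"
    and t_zero [simp]: "a \<in> carrier F \<Longrightarrow> t \<zero> a = \<zero>" "a \<in> carrier F \<Longrightarrow> t a \<zero> = \<zero>"
    and t_cocycle: "a \<in> carrier F \<Longrightarrow> b \<in> carrier F \<Longrightarrow> c \<in> carrier F \<Longrightarrow>
      t a b \<oplus> t (a \<oplus> b) c = t a (b \<oplus> c) \<oplus> t b c"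
    and inj_enc: "inj enc"
begin

abbreviation "G \<equiv> twisted_heisenberg F t enc"

lemma G_simps:
  "enc (a, b, c) \<in> carrier G \<longleftrightarrow> a \<in> carrier F \<and> b \<in> carrier F \<and> c \<in> carrier F"
  "enc (a, b, c) \<otimes>\<^bsub>G\<^esub> enc (a', b', c') = enc (a \<oplus> a', b \<oplus> b', c \<oplus> c' \<oplus> (a \<otimes> b' \<oplus> t b b'))"
  "\<one>\<^bsub>G\<^esub> = enc (\<zero>, \<zero>, \<zero>)"
  "enc x = enc y \<longleftrightarrow> x = y"
  using inj_enc by (auto simp: twisted_heisenberg_def inj_eq)

lemma G_cases:
  assumes "x \<in> carrier G"
  obtains a b c where "x = enc (a, b, c)" "a \<in> carrier F" "b \<in> carrier F" "c \<in> carrier F"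
  using assms by (auto simp: twisted_heisenberg_def)

lemma group_G: "group G"
proof (rule groupI)
  fix x y assume "x \<in> carrier G" "y \<in> carrier G"
  then show "x \<otimes>\<^bsub>G\<^esub> y \<in> carrier G"
    by (elim G_cases) (simp add: G_simps)
next
  fix x y z assume "x \<in> carrier G" "y \<in> carrier G" "z \<in> carrier G"
  then show "x \<otimes>\<^bsub>G\<^esub> y \<otimes>\<^bsub>G\<^esub> z = x \<otimes>\<^bsub>G\<^esub> (y \<otimes>\<^bsub>G\<^esub> z)"
  proof (elim G_cases)
    fix a b c a' b' c' a'' b'' c''
    assume xyz: "x = enc (a, b, c)" "y = enc (a', b', c')" "z = enc (a'', b'', c'')"
      and closed: "a \<in> carrier F" "b \<in> carrier F" "c \<in> carrier F" "a' \<in> carrier F"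
      "b' \<in> carrier F" "c' \<in> carrier F" "a'' \<in> carrier F" "b'' \<in> carrier F" "c'' \<in> carrier F"
    \<comment> \<open>\<open>?X\<close> collects the terms free of \<open>t\<close>; what remains
      are the two sides of \<open>t_cocycle\<close>.\<close>
    let ?X = "c \<oplus> c' \<oplus> c'' \<oplus> a \<otimes> b' \<oplus> a \<otimes> b'' \<oplus> a' \<otimes> b''"
    have "c \<oplus> c' \<oplus> (a \<otimes> b' \<oplus> t b b') \<oplus> c'' \<oplus> ((a \<oplus> a') \<otimes> b'' \<oplus> t (b \<oplus> b') b'')
        = ?X \<oplus> (t b b' \<oplus> t (b \<oplus> b') b'')"
      using closed by (simp add: l_distr a_ac)
    also have "\<dots> = ?X \<oplus> (t b (b' \<oplus> b'') \<oplus> t b' b'')"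
      using closed by (simp add: t_cocycle)
    also have "\<dots> = c \<oplus> (c' \<oplus> c'' \<oplus> (a' \<otimes> b'' \<oplus> t b' b'')) \<oplus> (a \<otimes> (b' \<oplus> b'') \<oplus> t b (b' \<oplus> b''))"
      using closed by (simp add: r_distr a_ac)
    finally show ?thesis
      using closed by (simp add: xyz G_simps a_assoc)
  qed
next
  fix x assume "x \<in> carrier G"
  then show "\<one>\<^bsub>G\<^esub> \<otimes>\<^bsub>G\<^esub> x = x"
    by (elim G_cases) (simp add: G_simps)
next
  fix x assume "x \<in> carrier G"
  then show "\<exists>y \<in> carrier G. y \<otimes>\<^bsub>G\<^esub> x = \<one>\<^bsub>G\<^esub>"
  proof (elim G_cases)
    fix a b c assume x: "x = enc (a, b, c)" and closed: "a \<in> carrier F" "b \<in> carrier F" "c \<in> carrier F"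
    let ?y = "enc (\<ominus> a, \<ominus> b, \<ominus> (c \<oplus> (\<ominus> a \<otimes> b \<oplus> t (\<ominus> b) b)))"
    have "\<ominus> (c \<oplus> d) \<oplus> c \<oplus> d = \<zero>" if "d \<in> carrier F" for d
      using that closed by (simp add: a_assoc l_neg)
    then have "?y \<otimes>\<^bsub>G\<^esub> x = \<one>\<^bsub>G\<^esub>"
      using closed by (simp add: x G_simps l_neg)
    moreover have "?y \<in> carrier G"
      using closed by (simp add: G_simps)
    ultimately show ?thesis
      by blast
  qed
qed (simp add: G_simps)

lemma exists_noncommuting:
  assumes closed: "a \<in> carrier F" "b \<in> carrier F" "c \<in> carrier F" "z \<in> carrier F"
    and nonzero: "a \<noteq> \<zero> \<or> b \<noteq> \<zero>"
  shows "\<exists>y \<in> carrier G. enc (a, b, c) \<otimes>\<^bsub>G\<^esub> y = enc (\<zero>, \<zero>, z) \<otimes>\<^bsub>G\<^esub> (y \<otimes>\<^bsub>G\<^esub> enc (a, b, c))"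
proof (cases "b = \<zero>")
  case False
  then have b: "inv b \<in> carrier F" "inv b \<otimes> b = \<one>"
    using closed field_Units by auto
  \<comment> \<open>Against a partner (a', 0, 0) the commutator has third coordinate - a' b;
    equating it with z gives a' = - z / b.\<close>
  have "\<ominus> (z \<otimes> inv b) \<otimes> b = \<ominus> z"
    using closed b by (simp add: l_minus m_assoc)
  moreover have "z \<oplus> (c \<oplus> \<ominus> z) = c"
    using closed by (simp add: a_lcomm r_neg)
  ultimately have "enc (a, b, c) \<otimes>\<^bsub>G\<^esub> enc (\<ominus> (z \<otimes> inv b), \<zero>, \<zero>)
      = enc (\<zero>, \<zero>, z) \<otimes>\<^bsub>G\<^esub> (enc (\<ominus> (z \<otimes> inv b), \<zero>, \<zero>) \<otimes>\<^bsub>G\<^esub> enc (a, b, c))"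
    using closed b by (simp add: G_simps a_comm)
  moreover have "enc (\<ominus> (z \<otimes> inv b), \<zero>, \<zero>) \<in> carrier G"
    using closed b by (simp add: G_simps)
  ultimately show ?thesis
    by blast
next
  case True
  then have a: "inv a \<in> carrier F" "a \<otimes> inv a = \<one>"
    using nonzero closed field_Units by auto
  \<comment> \<open>With b = 0, a partner (0, b', 0) gives the commutator a b'; equating it with z
    gives b' = z / a.\<close>
  have "a \<otimes> (inv a \<otimes> z) = z"
    using closed a by (simp flip: m_assoc)
  then have "enc (a, b, c) \<otimes>\<^bsub>G\<^esub> enc (\<zero>, inv a \<otimes> z, \<zero>)
      = enc (\<zero>, \<zero>, z) \<otimes>\<^bsub>G\<^esub> (enc (\<zero>, inv a \<otimes> z, \<zero>) \<otimes>\<^bsub>G\<^esub> enc (a, b, c))"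
    using closed a True by (simp add: G_simps a_comm)
  moreover have "enc (\<zero>, inv a \<otimes> z, \<zero>) \<in> carrier G"
    using closed a by (simp add: G_simps)
  ultimately show ?thesis
    by blast
qed

lemma group_center_G: "group_center G = (\<lambda>c. enc (\<zero>, \<zero>, c)) ` carrier F"
proof
  show "(\<lambda>c. enc (\<zero>, \<zero>, c)) ` carrier F \<subseteq> group_center G"
    by (auto simp: group_center_def G_simps a_comm elim!: G_cases)
  show "group_center G \<subseteq> (\<lambda>c. enc (\<zero>, \<zero>, c)) ` carrier F"
  proof
    fix x assume x: "x \<in> group_center G"
    then have "x \<in> carrier G"
      by (simp add: group_center_def)
    then obtain a b c where abc: "x = enc (a, b, c)" "a \<in> carrier F" "b \<in> carrier F" "c \<in> carrier F"
      by (rule G_cases)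
    have "a = \<zero> \<and> b = \<zero>"
    proof (rule ccontr)
      assume "\<not> (a = \<zero> \<and> b = \<zero>)"
      \<comment> \<open>Any nonzero prescribed commutator contradicts centrality;
        \<open>\<one>\<close> is taken.\<close>
      then obtain y where y: "y \<in> carrier G" "x \<otimes>\<^bsub>G\<^esub> y = enc (\<zero>, \<zero>, \<one>) \<otimes>\<^bsub>G\<^esub> (y \<otimes>\<^bsub>G\<^esub> x)"
        using exists_noncommuting[of a b c \<one>] abc by auto
      obtain d e f where yx: "y \<otimes>\<^bsub>G\<^esub> x = enc (d, e, f)" "d \<in> carrier F" "e \<in> carrier F" "f \<in> carrier F"
        using group.is_monoid[OF group_G] y(1) \<open>x \<in> carrier G\<close> monoid.m_closed G_cases by metis
      have "x \<otimes>\<^bsub>G\<^esub> y = y \<otimes>\<^bsub>G\<^esub> x"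
        using x y(1) by (simp add: group_center_def)
      then have "enc (d, e, f) = enc (\<zero>, \<zero>, \<one>) \<otimes>\<^bsub>G\<^esub> enc (d, e, f)"
        using y(2) yx(1) by simp
      then have "f = \<one> \<oplus> f"
        using yx by (simp add: G_simps)
      then show False
        using yx(4) by (metis l_zero local.add.right_cancel one_closed one_not_zero zero_closed)
    qed
    then show "x \<in> (\<lambda>c. enc (\<zero>, \<zero>, c)) ` carrier F"
      using abc by simp
  qed
qed

lemma ultraspecial_G:
  assumes p: "Factorial_Ring.prime p" and fin: "finite (carrier F)"
    and order: "order F = p ^ n" and torsion: "\<And>a. a \<in> carrier F \<Longrightarrow> [p] \<cdot> a = \<zero>"
  shows "ultraspecial p G"
proof -
  interpret G: group G by (rule group_G)
  have "inj_on enc A" for A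
    using inj_enc inj_on_subset by blast
  then have order_G: "order G = order F ^ 3" and fin_G: "finite (carrier G)"
    using fin by (simp_all add: order_def twisted_heisenberg_def card_image card_cartesian_product power3_eq_cube)
  have card_center: "card (group_center G) = order F"
    unfolding group_center_G order_def by (intro card_image inj_onI) (simp add: G_simps)
  show ?thesis
  proof (rule G.ultraspecialI)
    have "order G = p ^ (n * 3)"
      by (simp add: order_G order power_mult)
    then show "finite_p_group p G"
      using p fin_G group_G by (auto simp: finite_p_group_def)
    have "enc (\<one>, \<zero>, \<zero>) \<notin> group_center G"
      by (auto simp: group_center_G G_simps)
    moreover have "enc (\<one>, \<zero>, \<zero>) \<in> carrier G"
      by (simp add: G_simps)
    ultimately show "group_center G \<noteq> carrier G"
      by blast
    show "\<exists>z \<in> group_center G. x \<otimes>\<^bsub>G\<^esub> y = z \<otimes>\<^bsub>G\<^esub> (y \<otimes>\<^bsub>G\<^esub> x)"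
      if "x \<in> carrier G" "y \<in> carrier G" for x y
      using that
    proof (elim G_cases)
      fix a b c a' b' c'
      assume xy: "x = enc (a, b, c)" "y = enc (a', b', c')"
        and closed: "a \<in> carrier F" "b \<in> carrier F" "c \<in> carrier F"
        "a' \<in> carrier F" "b' \<in> carrier F" "c' \<in> carrier F"
      \<comment> \<open>The third coordinates of the products in the two orders; their difference is
        the commutator.\<close>
      define u v where "u = c \<oplus> c' \<oplus> (a \<otimes> b' \<oplus> t b b')" and "v = c' \<oplus> c \<oplus> (a' \<otimes> b \<oplus> t b' b)"
      have uv: "u \<in> carrier F" "v \<in> carrier F"
        using closed by (simp_all add: u_def v_def)
      then have "(u \<ominus> v) \<oplus> v = u"
        by (simp add: minus_eq a_assoc l_neg)
      moreover have "x \<otimes>\<^bsub>G\<^esub> y = enc (a \<oplus> a', b \<oplus> b', u)" "y \<otimes>\<^bsub>G\<^esub> x = enc (a' \<oplus> a, b' \<oplus> b, v)"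
        by (simp_all add: xy G_simps u_def v_def)
      ultimately have "x \<otimes>\<^bsub>G\<^esub> y = enc (\<zero>, \<zero>, u \<ominus> v) \<otimes>\<^bsub>G\<^esub> (y \<otimes>\<^bsub>G\<^esub> x)"
        using closed uv by (simp add: G_simps a_comm[of a a'] a_comm[of b b'])
      then show ?thesis
        using uv by (auto simp: group_center_G)
    qed
    show "x [^]\<^bsub>G\<^esub> p \<in> group_center G" if "x \<in> carrier G" for x
      using that
    proof (elim G_cases)
      fix a b c assume x: "x = enc (a, b, c)" and closed: "a \<in> carrier F" "b \<in> carrier F" "c \<in> carrier F"
      \<comment> \<open>Only the first two coordinates of a power are tracked: they vanish at
        exponent \<open>p\<close>, and centrality leaves the third one free.\<close>
      have "\<exists>d \<in> carrier F. x [^]\<^bsub>G\<^esub> k = enc ([k] \<cdot> a, [k] \<cdot> b, d)" for k :: nat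
      proof (induction k)
        case (Suc k)
        then obtain d where "d \<in> carrier F" "x [^]\<^bsub>G\<^esub> k = enc ([k] \<cdot> a, [k] \<cdot> b, d)"
          by blast
        then show ?case
          using closed by (simp add: x G_simps)
      qed (simp add: G_simps)
      from this[of p] show ?thesis
        using closed torsion by (auto simp: group_center_G)
    qed
    show "\<exists>y \<in> carrier G. x \<otimes>\<^bsub>G\<^esub> y = z \<otimes>\<^bsub>G\<^esub> (y \<otimes>\<^bsub>G\<^esub> x)"
      if x: "x \<in> carrier G - group_center G" and z: "z \<in> group_center G" for x z
    proof -
      obtain a b c where abc: "x = enc (a, b, c)" "a \<in> carrier F" "b \<in> carrier F" "c \<in> carrier F"
        using x by (blast elim: G_cases)
      then have "a \<noteq> \<zero> \<or> b \<noteq> \<zero>"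
        using x by (auto simp: group_center_G)
      then show ?thesis
        using exists_noncommuting abc z by (auto simp: group_center_G)

section \<open>Embedding groups of class two\<close>

   qed
    show "order G = card (group_center G) ^ 3"
      by (simp add: order_G card_center)
  qed
qed

end

section \<open>Groups of class two and their embedding\<close>

lemma (in group) mult_eq_commutator_mult:
  assumes "x \<in> carrier G" and "y \<in> carrier G"
  shows "x \<otimes> y = x \<otimes> y \<otimes> inv x \<otimes> inv y \<otimes> (y \<otimes> x)"
proof -
  have "inv y \<otimes> (y \<otimes> x) = x"
    using assms by (simp flip: m_assoc)
  then show ?thesis
    using assms by (simp add: m_assoc)
qed

text \<open>As the series is indexed from 0, the hypothesis says that gamma_3 is trivial; it
  contains the commutators of [x, y] with every g.\<close>

lemma (in group) commutator_central:
  assumes "lower_central_series G 2 = {\<one>}" and "x \<in> carrier G" and "y \<in> carrier G"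
  shows "x \<otimes> y \<otimes> inv x \<otimes> inv y \<in> group_center G"
proof -
  let ?u = "x \<otimes> y \<otimes> inv x \<otimes> inv y"
  have uG: "?u \<in> carrier G"
    using assms(2,3) by simp
  have "?u \<in> lower_central_series G (Suc 0)"
    using assms(2,3) by (auto intro!: generate.incl)
  then have "?u \<otimes> g \<otimes> inv ?u \<otimes> inv g \<in> lower_central_series G 2" if "g \<in> carrier G" for g
    using that unfolding numeral_2_eq_2 lower_central_series.simps(2)[of G "Suc 0"]
    by (intro generate.incl) blast
  then have "?u \<otimes> g \<otimes> inv ?u \<otimes> inv g = \<one>" if "g \<in> carrier G" for g
    using that assms(1) by blast
  then have "g \<otimes> ?u = ?u \<otimes> g" if "g \<in> carrier G" for g
    using that uG mult_eq_commutator_mult[OF uG, of g] by (simp del: inv_mult_group)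
  then show ?thesis
    using uG by (simp add: group_center_def)
qed

theorem theorem1p1:
  fixes p :: nat and H :: "('a, 'b) monoid_scheme"
  assumes "Factorial_Ring.prime p" and "odd p"
    and "finite_p_group p H"
    and "nilpotent_group H" and "nilpotence_class H = 2"
    and "group_exponent H = p"
  shows "\<exists>(G :: nat monoid) K.
           ultraspecial p G \<and> subgroup K G \<and> G\<lparr>carrier := K\<rparr> \<cong> H"
proof -
  interpret H: group H
    using assms(4) by (simp add: nilpotent_group_def)
  let ?C = "group_center H"
  have fin: "finite (carrier H)"
    using assms(3) by (simp add: finite_p_group_def)
  \<comment> \<open>Nilpotency guarantees that the \<open>LEAST\<close> in the class is
    attained.\<close>
  have lcs: "lower_central_series H 2 = {\<one>\<^bsub>H\<^esub>}"
    using assms(4,5) LeastI_ex[of "\<lambda>n. lower_central_series H n = {\<one>\<^bsub>H\<^esub>}"]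
    by (simp add: nilpotent_group_def nilpotence_class_def)
  have pow: "x [^]\<^bsub>H\<^esub> p = \<one>\<^bsub>H\<^esub>" if "x \<in> carrier H" for x
    using that assms(6) H.pow_eq_id[OF that, of p] by (metis dvd_Lcm group_exponent_def imageI)
  interpret C: normal ?C H
    by (intro H.subgroup_center_normal H.subgroup_group_center order.refl)
  have V: "elementary_abelian p (H Mod ?C)"
  proof (rule C.FactGroup_elementary_abelian[OF assms(3)])
    fix x y assume xy: "x \<in> carrier H" "y \<in> carrier H"
    have "x \<otimes>\<^bsub>H\<^esub> y = x \<otimes>\<^bsub>H\<^esub> y \<otimes>\<^bsub>H\<^esub> inv\<^bsub>H\<^esub> x \<otimes>\<^bsub>H\<^esub> inv\<^bsub>H\<^esub> y \<otimes>\<^bsub>H\<^esub> (y \<otimes>\<^bsub>H\<^esub> x)"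
      using xy by (rule H.mult_eq_commutator_mult)
    then show "x \<otimes>\<^bsub>H\<^esub> y \<in> ?C #>\<^bsub>H\<^esub> (y \<otimes>\<^bsub>H\<^esub> x)"
      using H.commutator_central[OF lcs xy] xy H.rcosI[OF _ C.subset] by (metis H.m_closed)
  qed (simp add: pow C.one_closed)
  interpret Z: group "H\<lparr>carrier := ?C\<rparr>"
    using C.subgroup_axioms by (rule H.subgroup_imp_group)
  have "x \<otimes>\<^bsub>H\<^esub> y = y \<otimes>\<^bsub>H\<^esub> x" if "x \<in> ?C" "y \<in> ?C" for x y
    using that unfolding group_center_def by blast
  then interpret Z: comm_group "H\<lparr>carrier := ?C\<rparr>"
    by (intro Z.group_comm_groupI) simp
  have C: "elementary_abelian p (H\<lparr>carrier := ?C\<rparr>)"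
  proof (rule Z.elementary_abelianI[OF assms(1)])
    show "finite (carrier (H\<lparr>carrier := ?C\<rparr>))"
      using fin finite_subset C.subset by auto
    show "x [^]\<^bsub>H\<lparr>carrier := ?C\<rparr>\<^esub> p = \<one>\<^bsub>H\<lparr>carrier := ?C\<rparr>\<^esub>"
      if "x \<in> carrier (H\<lparr>carrier := ?C\<rparr>)" for x
      using that pow C.mem_carrier by (simp flip: H.nat_pow_consistent)
  qed
  obtain F :: "nat ring" where F: "field F" "finite (carrier F)" "order H \<le> card (carrier F)"
    and torsion: "\<And>x. x \<in> carrier F \<Longrightarrow> [p] \<cdot>\<^bsub>F\<^esub> x = \<zero>\<^bsub>F\<^esub>"
    using exists_finite_field[OF assms(1,2)] by metis
  interpret F: field F by (rule F)
  have A: "elementary_abelian p (add_monoid F)"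
    using F(2) torsion by (intro F.a_comm_group[THEN comm_group.elementary_abelianI] assms(1))
      (simp_all add: add_pow_def)
  \<comment> \<open>|H| bounds the orders of the central quotient and of the centre, so one field
    receives both.\<close>
  have le_V: "order (H Mod ?C) \<le> order (add_monoid F)"
    using F(3) card_image_le[OF fin] by (auto simp: order_def carrier_FactGroup intro: order_trans)
  have le_C: "order (H\<lparr>carrier := ?C\<rparr>) \<le> order (add_monoid F)"
    using F(3) card_mono[OF fin C.subset] by (auto simp: order_def)
  obtain i r where ir: "i \<in> hom (H Mod ?C) (add_monoid F)" "r \<in> hom (add_monoid F) (H Mod ?C)"
    "\<And>v. v \<in> carrier (H Mod ?C) \<Longrightarrow> r (i v) = v"
    using elementary_abelian_retract[OF V A le_V] by blast
  \<comment> \<open>Here the retraction \<open>s\<close> serves to show that \<open>j\<close> is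
    injective.\<close>
  obtain j s where js: "j \<in> hom (H\<lparr>carrier := ?C\<rparr>) (add_monoid F)"
    "s \<in> hom (add_monoid F) (H\<lparr>carrier := ?C\<rparr>)"
    "\<And>c. c \<in> carrier (H\<lparr>carrier := ?C\<rparr>) \<Longrightarrow> s (j c) = c"
    by (rule elementary_abelian_retract[OF C A le_C]) (rule that, assumption+)
  have inj_j: "inj_on j ?C"
    using js(3) by (intro inj_on_inverseI) simp
  let ?A = "add_monoid F"
  obtain t \<pi> \<kappa> where t: "\<And>a b. a \<in> carrier ?A \<Longrightarrow> b \<in> carrier ?A \<Longrightarrow> t a b \<in> carrier ?A"
    "\<And>a. a \<in> carrier ?A \<Longrightarrow> t \<one>\<^bsub>?A\<^esub> a = \<one>\<^bsub>?A\<^esub>" "\<And>a. a \<in> carrier ?A \<Longrightarrow> t a \<one>\<^bsub>?A\<^esub> = \<one>\<^bsub>?A\<^esub>"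
    "\<And>a b c. a \<in> carrier ?A \<Longrightarrow> b \<in> carrier ?A \<Longrightarrow> c \<in> carrier ?A \<Longrightarrow>
      t a b \<otimes>\<^bsub>?A\<^esub> t (a \<otimes>\<^bsub>?A\<^esub> b) c = t a (b \<otimes>\<^bsub>?A\<^esub> c) \<otimes>\<^bsub>?A\<^esub> t b c"
    and \<pi>: "\<pi> \<in> hom H ?A" and \<kappa>: "\<And>x. x \<in> carrier H \<Longrightarrow> \<kappa> x \<in> carrier ?A"
    and \<kappa>_mult: "\<And>x y. x \<in> carrier H \<Longrightarrow> y \<in> carrier H \<Longrightarrow>
      \<kappa> (x \<otimes>\<^bsub>H\<^esub> y) = \<kappa> x \<otimes>\<^bsub>?A\<^esub> \<kappa> y \<otimes>\<^bsub>?A\<^esub> t (\<pi> x) (\<pi> y)"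
    and inj: "inj_on (\<lambda>x. (\<pi> x, \<kappa> x)) (carrier H)"
    by (rule H.central_extension_cocycle[OF H.subgroup_group_center order.refl F.a_comm_group ir js(1) inj_j])
      (assumption, rule that, assumption+)
  \<comment> \<open>The group is sought on natural numbers, so triples are coded
    injectively.\<close>
  define enc :: "nat \<times> nat \<times> nat \<Rightarrow> nat" where "enc = to_nat"
  interpret G: additive_cocycle F t enc
    by unfold_locales (use t in \<open>simp_all add: enc_def\<close>)
  interpret G: group G.G by (rule G.group_G)
  obtain n where "order F = p ^ n"
    using A by (auto simp: elementary_abelian_def finite_p_group_def order_def)
  then have "ultraspecial p G.G"
    using assms(1) F(2) torsion by (intro G.ultraspecial_G)
  \<comment> \<open>With first coordinate zero the term \<open>a \<otimes> b'\<close> vanishes, and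
    the rule for third coordinates becomes \<open>\<kappa>_mult\<close>.\<close>
  define e where "e x = enc (\<zero>\<^bsub>F\<^esub>, \<pi> x, \<kappa> x)" for x
  have \<pi>_closed: "\<pi> x \<in> carrier F" if "x \<in> carrier H" for x
    using that \<pi> hom_in_carrier by fastforce
  have e: "e \<in> hom H G.G"
  proof (rule homI)
    show "e x \<in> carrier G.G" if "x \<in> carrier H" for x
      using that \<pi>_closed \<kappa> by (simp add: e_def G.G_simps)
    show "e (x \<otimes>\<^bsub>H\<^esub> y) = e x \<otimes>\<^bsub>G.G\<^esub> e y" if "x \<in> carrier H" "y \<in> carrier H" for x y
      using that \<pi>_closed \<kappa> hom_mult[OF \<pi>] t(1) by (simp add: e_def G.G_simps \<kappa>_mult)
  qed
  then interpret e: group_hom H G.G e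
    by (simp add: group_hom_def group_hom_axioms_def H.is_group G.is_group)
  have sub: "subgroup (e ` carrier H) G.G"
    by (rule e.img_is_subgroup)
  have "inj_on e (carrier H)"
    using inj by (auto simp: inj_on_def e_def G.G_simps)
  then have "e \<in> iso H (G.G\<lparr>carrier := e ` carrier H\<rparr>)"
    using e by (auto simp: iso_def hom_def bij_betw_def)
  then have "G.G\<lparr>carrier := e ` carrier H\<rparr> \<cong> H"
    using H.iso_sym is_isoI by blast
  with sub \<open>ultraspecial p G.G\<close> show ?thesis
    by blast
qed

end
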